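(* Assume $0<\lambda<2$, let $d\geq 1$ be an arbitrary integer, and let $(a_n)_{n=0}^{\infty}\subset S^d$ be a greedy $\lambda$-energy sequence. Let $\alpha_{N,\lambda}=(a_0,\ldots,a_{N-1})$ and $\sigma_{N,\lambda}=\frac1N\sum_{k=0}^{N-1}\delta_{a_k}$. Then $$N(N-1)\,I_\lambda(\sigma_d)<H_\lambda(\alpha_{N,\lambda})<N^2\,I_\lambda(\sigma_d),\qquad N\geq 2.$$ In particular, $$\lim_{N\to\infty}\frac{H_\lambda(\alpha_{N,\lambda})}{N^2}=I_\lambda(\sigma_d).$$ Moreover, $\sigma_{N,\lambda}$ converges to $\sigma_d$ in the weak-star topology as $N\to\infty$.
   Context: $S^d=\{x\in\mathbb{R}^{d+1}:|x|=1\}$, where $|\cdot|$ is the Euclidean norm. For $\lambda>0$, a greedy $\lambda$-energy sequence on $S^d$ is a sequence $(a_n)_{n=0}^{\infty}\subset S^d$ such that $\sum_{k=0}^{n-1}|a_n-a_k|^{\lambda}=\max_{x\in S^d}\sum_{k=0}^{n-1}|x-a_k|^{\lambda}$ for all $n\geq 1$. For a configuration $\omega_N=(y_0,\ldots,y_{N-1})$ of $N\ge 2$ points of $S^d$ (not necessarily distinct), $H_\lambda(\omega_N)=\sum_{0\le i\neq j\le N-1}|y_i-y_j|^\lambda=2\sum_{0\le i<j\le N-1}|y_i-y_j|^{\lambda}$. $\sigma_d$ is the normalized uniform (rotation-invariant probability) measure on $S^d$, and for a probability measure $\mu$ on $S^d$, $I_\lambda(\mu)=\iint_{S^d\times S^d}|x-y|^\lambda\,d\mu(x)\,d\mu(y)$.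 $\delta_a$ is the Dirac unit measure at $a$. Weak-star convergence $\mu_n\to\mu$ means $\int f\,d\mu_n\to\int f\,d\mu$ for every continuous $f:S^d\to\mathbb{R}$. *)

theory Defs
  imports "HOL-Probability.Probability"
begin

section \<open>Measures on the unit sphere\<close>

text \<open>
  Measures on the sphere live on the subspace Borel algebra, so that a function continuous on
  the sphere is measurable whatever values it takes elsewhere.
\<close>

abbreviation unit_sphere :: "'a::euclidean_space set" where
  "unit_sphere \<equiv> sphere 0 1"

abbreviation sphere_borel :: "'a::euclidean_space measure" where
  "sphere_borel \<equiv> restrict_space borel unit_sphere"

text \<open>
  The normalized uniform measure, realized as the cone measure: the image of the normalized
  Lebesgue measure of the unit ball under radial projection. The junk value of the projection
  at the origin concerns a null set only. The lemmas \<open>prob_space_sphere_uniform\<close> and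
  \<open>sphere_uniform_rotation_invariant\<close> below confirm that this is a rotation-invariant probability
  measure.
\<close>

definition sphere_uniform :: "'a::euclidean_space measure" where
  "sphere_uniform =
     restrict_space
       (distr (uniform_measure lborel (ball 0 1)) borel (\<lambda>x. x /\<^sub>R norm x)) unit_sphere"

definition empirical_measure :: "nat \<Rightarrow> (nat \<Rightarrow> 'a::euclidean_space) \<Rightarrow> 'a measure" where
  "empirical_measure N a =
     measure_of unit_sphere (sets sphere_borel)
       (\<lambda>A. ennreal (1 / real N) * (\<Sum>k<N. emeasure (return sphere_borel (a k)) A))"

definition weak_star_converges ::
    "(nat \<Rightarrow> 'a::euclidean_space measure) \<Rightarrow> 'a measure \<Rightarrow> bool" where
  "weak_star_converges \<mu> \<nu> \<longleftrightarrow>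
     (\<forall>f::'a \<Rightarrow> real. continuous_on unit_sphere f \<longrightarrow>
        (\<lambda>n. \<integral>x. f x \<partial>\<mu> n) \<longlonglongrightarrow> (\<integral>x. f x \<partial>\<nu>))"


section \<open>Riesz energies with positive exponent\<close>

text \<open>
  Only positive exponents are intended, for which \<open>0 powr lam = 0\<close> is the correct
  value at coinciding points.
\<close>

definition discrete_energy :: "real \<Rightarrow> nat \<Rightarrow> (nat \<Rightarrow> 'a::euclidean_space) \<Rightarrow> real" where
  "discrete_energy lam N y =
     (\<Sum>(i, j) \<in> {(i, j). i < N \<and> j < N \<and> i \<noteq> j}. norm (y i - y j) powr lam)"

definition continuous_energy :: "real \<Rightarrow> 'a::euclidean_space measure \<Rightarrow> real" where
  "continuous_energy lam \<mu> = (\<integral>x. (\<integral>y. norm (x - y) powr lam \<partial>\<mu>) \<partial>\<mu>)"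

definition greedy_energy_sequence :: "real \<Rightarrow> (nat \<Rightarrow> 'a::euclidean_space) \<Rightarrow> bool" where
  "greedy_energy_sequence lam a \<longleftrightarrow>
     (\<forall>n. a n \<in> unit_sphere) \<and>
     (\<forall>n\<ge>1. \<forall>x\<in>unit_sphere.
        (\<Sum>k<n. norm (x - a k) powr lam) \<le> (\<Sum>k<n. norm (a n - a k) powr lam))"


section \<open>Basic properties\<close>

lemma space_sphere_uniform [simp]: "space sphere_uniform = unit_sphere"
  by (simp add: sphere_uniform_def space_restrict_space)

lemma sets_sphere_uniform [simp, measurable_cong]: "sets sphere_uniform = sets sphere_borel"
  by (simp add: sphere_uniform_def sets_restrict_space)

lemma emeasure_sphere_uniform:
  fixes A :: "'a::euclidean_space set"
  assumes "A \<in> sets sphere_borel"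
  shows "emeasure sphere_uniform A =
    emeasure lborel {x \<in> ball 0 1. x /\<^sub>R norm x \<in> A} / emeasure lborel (ball 0 1 :: 'a set)"
proof -
  have A: "A \<in> sets borel" "A \<subseteq> unit_sphere"
    using assms by (auto simp: sets_restrict_space_iff)
  have [measurable]: "(\<lambda>x::'a. x /\<^sub>R norm x) \<in> borel_measurable borel"
    by measurable
  have pre: "(\<lambda>x::'a. x /\<^sub>R norm x) -` A \<in> sets borel"
    using measurable_sets[of "\<lambda>x::'a. x /\<^sub>R norm x" borel borel A] A by simp
  have "emeasure sphere_uniform A =
      emeasure (distr (uniform_measure lborel (ball 0 1)) borel (\<lambda>x. x /\<^sub>R norm x)) A"
    unfolding sphere_uniform_def using A by (subst emeasure_restrict_space) auto
  also have "\<dots> = emeasure (uniform_measure lborel (ball 0 1)) ((\<lambda>x::'a. x /\<^sub>R norm x) -` A)"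
    using A by (subst emeasure_distr) auto
  also have "\<dots> = emeasure lborel (ball 0 1 \<inter> (\<lambda>x::'a. x /\<^sub>R norm x) -` A) / emeasure lborel (ball 0 1 :: 'a set)"
    using pre by (subst emeasure_uniform_measure) auto
  also have "ball 0 1 \<inter> (\<lambda>x::'a. x /\<^sub>R norm x) -` A = {x \<in> ball 0 1. x /\<^sub>R norm x \<in> A}"
    by auto
  finally show ?thesis .
qed

lemma emeasure_lborel_unit_ball:
  "emeasure lborel (ball 0 1 :: 'a::euclidean_space set) \<noteq> 0"
  "emeasure lborel (ball 0 1 :: 'a::euclidean_space set) \<noteq> \<infinity>"
  using content_ball_pos[of 1 "0::'a"] emeasure_bounded_finite[of "ball 0 1 :: 'a set"]
  by (auto simp: measure_def less_top[symmetric])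

lemma prob_space_sphere_uniform: "prob_space (sphere_uniform :: 'a::euclidean_space measure)"
proof
  have "{x \<in> ball 0 1. x /\<^sub>R norm x \<in> unit_sphere} = ball 0 1 - {0::'a}"
    by auto
  moreover have "emeasure lborel (ball 0 1 - {0::'a}) = emeasure lborel (ball 0 1 :: 'a set)"
    by (rule emeasure_Diff_null_set) auto
  ultimately have "emeasure sphere_uniform (unit_sphere :: 'a set) = 1"
    using emeasure_lborel_unit_ball[where 'a = 'a]
    by (subst emeasure_sphere_uniform)
       (auto simp: sets_restrict_space_iff less_top)
  then show "emeasure sphere_uniform (space (sphere_uniform :: 'a measure)) = 1"
    by simp
qed

lemma nn_integral_lborel_translate:
  fixes f :: "'a::euclidean_space \<Rightarrow> ennreal"
  assumes [measurable]: "f \<in> borel_measurable borel"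
  shows "(\<integral>\<^sup>+x. f (c + x) \<partial>lborel) = (\<integral>\<^sup>+x. f x \<partial>lborel)"
  using nn_integral_distr[of "(+) c" lborel borel f] lborel_distr_plus[of c] by simp

lemma nn_integral_lborel_reflect:
  fixes f :: "'a::euclidean_space \<Rightarrow> ennreal"
  assumes [measurable]: "f \<in> borel_measurable borel"
  shows "(\<integral>\<^sup>+x. f (c - x) \<partial>lborel) = (\<integral>\<^sup>+x. f x \<partial>lborel)"
proof -
  have "lborel = distr lborel borel (\<lambda>x::'a. c - x)"
    by (subst lborel_affine[of "-1" c]) (auto simp: density_1 one_ennreal_def[symmetric])
  then show ?thesis
    using nn_integral_distr[of "\<lambda>x. c - x" lborel borel f] by simp
qed

lemma borel_measurable_orthogonal_transformation:
  fixes T :: "'a::euclidean_space \<Rightarrow> 'a"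
  assumes "orthogonal_transformation T"
  shows "T \<in> borel_measurable borel"
  using orthogonal_transformation_linear[OF assms]
  by (intro borel_measurable_continuous_onI linear_continuous_on)
     (simp add: linear_conv_bounded_linear)

lemma emeasure_lborel_orthogonal_vimage:
  fixes T :: "'a::euclidean_space \<Rightarrow> 'a"
  assumes T: "orthogonal_transformation T" and A [measurable]: "A \<in> sets borel"
  shows "emeasure lborel (T -` A) = emeasure lborel A"
proof -
  have lin: "linear T" and nrm: "\<And>x. norm (T x) = norm x" and "bij T"
    using T by (auto simp: orthogonal_transformation_linear orthogonal_transformation_norm
        orthogonal_transformation_bij)
  note [measurable] = borel_measurable_orthogonal_transformation[OF T]
  define B :: "'a set" where "B = ball 0 1"
  have [measurable]: "B \<in> sets borel"
    by (simp add: B_def)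
  have vim: "(\<integral>\<^sup>+x. indicator D (T x) \<partial>lborel) = emeasure lborel (T -` D)"
    if "D \<in> sets borel" for D
  proof -
    have "T -` D \<in> sets lborel"
      using measurable_sets[OF borel_measurable_orthogonal_transformation[OF T] that] by simp
    moreover have "indicator D (T x) = (indicator (T -` D) x :: ennreal)" for x
      by (simp add: indicator_def)
    ultimately show ?thesis
      by (simp only: nn_integral_indicator)
  qed
  have "emeasure lborel (T -` A) * emeasure lborel B =
      (\<integral>\<^sup>+x. indicator A (T x) * (\<integral>\<^sup>+y. indicator B y \<partial>lborel) \<partial>lborel)"
    by (simp add: vim nn_integral_multc)
  also have "\<dots> = (\<integral>\<^sup>+x. indicator A (T x) * (\<integral>\<^sup>+y. indicator B (T x + y) \<partial>lborel) \<partial>lborel)"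
    by (subst nn_integral_lborel_translate) auto
  also have "\<dots> = (\<integral>\<^sup>+x. (\<integral>\<^sup>+y. indicator A (T x) * indicator B (T x + y) \<partial>lborel) \<partial>lborel)"
    by (intro nn_integral_cong nn_integral_cmult[symmetric]) measurable
  also have "\<dots> = (\<integral>\<^sup>+y. (\<integral>\<^sup>+x. indicator A (T x) * indicator B (T x + y) \<partial>lborel) \<partial>lborel)"
    by (rule lborel_pair.Fubini') measurable
  also have "\<dots> = (\<integral>\<^sup>+y. (\<integral>\<^sup>+x. indicator A (T x - y) * indicator B (T x) \<partial>lborel) \<partial>lborel)"
  proof (rule nn_integral_cong)
    fix y
    obtain z where z: "T z = y"
      using \<open>bij T\<close> by (metis bij_pointE)
    show "(\<integral>\<^sup>+x. indicator A (T x) * indicator B (T x + y) \<partial>lborel) =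
        (\<integral>\<^sup>+x. indicator A (T x - y) * indicator B (T x) \<partial>lborel)"
      using nn_integral_lborel_translate
          [of "\<lambda>x. indicator A (T x - y) * indicator B (T x)" z]
      by (simp add: linear_add[OF lin] z add.commute)
  qed
  also have "\<dots> = (\<integral>\<^sup>+x. (\<integral>\<^sup>+y. indicator A (T x - y) * indicator B (T x) \<partial>lborel) \<partial>lborel)"
    by (rule lborel_pair.Fubini') measurable
  also have "\<dots> = (\<integral>\<^sup>+x. (\<integral>\<^sup>+y. indicator A (T x - y) \<partial>lborel) * indicator B (T x) \<partial>lborel)"
    by (intro nn_integral_cong nn_integral_multc) measurable
  also have "\<dots> = (\<integral>\<^sup>+x. emeasure lborel A * indicator B (T x) \<partial>lborel)"
    by (subst nn_integral_lborel_reflect) auto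
  also have "\<dots> = emeasure lborel A * emeasure lborel (T -` B)"
    by (simp add: nn_integral_cmult vim)
  also have "T -` B = B"
    by (auto simp: B_def nrm)
  finally show ?thesis
    using emeasure_lborel_unit_ball[where 'a = 'a]
    by (auto simp: B_def mult.commute[of _ "emeasure lborel (ball 0 1)"] ennreal_mult_cancel_left)
qed

lemma sphere_uniform_rotation_invariant:
  fixes T :: "'a::euclidean_space \<Rightarrow> 'a"
  assumes T: "orthogonal_transformation T"
  shows "distr sphere_uniform sphere_borel T = sphere_uniform"
proof (rule measure_eqI)
  show "sets (distr sphere_uniform sphere_borel T) = sets sphere_uniform"
    by simp
next
  fix A :: "'a set"
  assume "A \<in> sets (distr sphere_uniform sphere_borel T)"
  then have A: "A \<in> sets sphere_borel" by simp
  have lin: "linear T" and nrm: "\<And>x. norm (T x) = norm x"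
    using T by (auto simp: orthogonal_transformation_linear orthogonal_transformation_norm)
  note [measurable] = borel_measurable_orthogonal_transformation[OF T]
  have Tm: "T \<in> measurable sphere_borel sphere_borel"
    by (intro measurable_restrict_space2 measurable_restrict_space1)
       (auto simp: space_restrict_space nrm)
  then have Tm': "T \<in> measurable sphere_uniform sphere_borel"
    using measurable_cong_sets[OF sets_sphere_uniform refl] by blast
  let ?B = "T -` A \<inter> unit_sphere"
  have B: "?B \<in> sets sphere_borel"
    using measurable_sets[OF Tm A] by (simp add: space_restrict_space)
  let ?C = "\<lambda>D. {x \<in> ball 0 1. x /\<^sub>R norm x \<in> D} :: 'a set"
  have A': "A \<in> sets borel" "A \<subseteq> unit_sphere"
    using A by (auto simp: sets_restrict_space_iff)
  have "(\<lambda>x::'a. x /\<^sub>R norm x) -` A \<inter> space borel \<in> sets borel"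
    by (rule measurable_sets[OF _ A'(1)]) measurable
  then have "ball 0 1 \<inter> (\<lambda>x::'a. x /\<^sub>R norm x) -` A \<in> sets borel"
    by auto
  also have "ball 0 1 \<inter> (\<lambda>x::'a. x /\<^sub>R norm x) -` A = ?C A"
    by auto
  finally have C: "?C A \<in> sets borel" .
  have iff: "x /\<^sub>R norm x \<in> ?B \<longleftrightarrow> T x /\<^sub>R norm (T x) \<in> A" for x
  proof -
    have "T (x /\<^sub>R norm x) = T x /\<^sub>R norm (T x)"
      by (simp add: linear_scale[OF lin] nrm)
    moreover have "x /\<^sub>R norm x \<in> unit_sphere" if "T (x /\<^sub>R norm x) \<in> A"
      using subsetD[OF A'(2) that] by (simp only: nrm mem_sphere_0)
    ultimately show ?thesis by auto
  qed
  have "T -` ?C A = ?C ?B"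
    unfolding iff by (auto simp: nrm)
  then have "emeasure sphere_uniform ?B = emeasure sphere_uniform A"
    using emeasure_lborel_orthogonal_vimage[OF T C]
    by (simp only: emeasure_sphere_uniform[OF A] emeasure_sphere_uniform[OF B])
  then show "emeasure (distr sphere_uniform sphere_borel T) A = emeasure sphere_uniform A"
    using emeasure_distr[OF Tm' A] by simp
qed

lemma space_empirical_measure [simp]: "space (empirical_measure N a) = unit_sphere"
  unfolding empirical_measure_def
  using sets.space_closed[of sphere_borel] by (intro space_measure_of) (simp add: space_restrict_space)

lemma sets_empirical_measure [simp, measurable_cong]:
  "sets (empirical_measure N a) = sets sphere_borel"
  unfolding empirical_measure_def
  using sets.sets_measure_of_eq[of sphere_borel] by (simp add: space_restrict_space)

lemma emeasure_empirical_measure: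
  assumes "A \<in> sets sphere_borel"
  shows "emeasure (empirical_measure N a) A =
    ennreal (1 / real N) * (\<Sum>k<N. emeasure (return sphere_borel (a k)) A)"
proof (rule emeasure_measure_of[OF empirical_measure_def])
  show "sets sphere_borel \<subseteq> Pow unit_sphere"
    using sets.space_closed[of sphere_borel] by (simp add: space_restrict_space)
  show "A \<in> sets (empirical_measure N a)"
    using assms by simp
  show "positive (sets (empirical_measure N a))
      (\<lambda>A. ennreal (1 / real N) * (\<Sum>k<N. emeasure (return sphere_borel (a k)) A))"
    by (simp add: positive_def)
  show "countably_additive (sets (empirical_measure N a))
      (\<lambda>A. ennreal (1 / real N) * (\<Sum>k<N. emeasure (return sphere_borel (a k)) A))"
    unfolding countably_additive_def
  proof (intro allI impI)
    fix F :: "nat \<Rightarrow> 'a set"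
    assume F: "range F \<subseteq> sets (empirical_measure N a)" "disjoint_family F"
    have "(\<Sum>i. emeasure (return sphere_borel (a k)) (F i)) =
        emeasure (return sphere_borel (a k)) (\<Union>i. F i)" for k
      using F by (intro suminf_emeasure) auto
    then show "(\<Sum>i. ennreal (1 / real N) * (\<Sum>k<N. emeasure (return sphere_borel (a k)) (F i))) =
        ennreal (1 / real N) * (\<Sum>k<N. emeasure (return sphere_borel (a k)) (\<Union>i. F i))"
      by (simp add: suminf_sum)
  qed
qed

end

theory Submission
  imports Defs
begin

text \<open>
  Let \<open>\<sigma>\<close> be the uniform measure, \<open>I\<close> its energy, \<open>\<nu>\<close> the empirical measure of \<open>N\<close> points of the
  sphere and \<open>H\<close> their discrete energy. On unit vectors
  \<open>norm (x - y) powr lam = 2 powr (lam / 2) * (1 - x \<bullet> y) powr (lam / 2)\<close>. For \<open>0 < lam < 2\<close> the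
  binomial series of \<open>(1 - s) powr (lam / 2)\<close> converges absolutely on the closed interval from
  \<open>-1\<close> to \<open>1\<close>, and every coefficient except the constant one is negative. The power
  \<open>(x \<bullet> y) ^ k\<close> is a sum of products \<open>m x * m y\<close> over monomials \<open>m\<close> of degree \<open>k\<close>, so its double
  integral against the signed measure \<open>\<nu> - \<sigma>\<close> is a sum of squares of differences
  \<open>(\<integral>x. m x \<partial>\<nu>) - (\<integral>x. m x \<partial>\<sigma>)\<close>. By rotation invariance the potential of \<open>\<sigma>\<close> is constant on the
  sphere, hence the energy of \<open>\<nu> - \<sigma>\<close> is \<open>H / N\<^sup>2 - I\<close>. Together
  (lemma \<open>energy_deficit_sums\<close>), the deficit \<open>I - H / N\<^sup>2\<close> is a combination, with positive weights,
  of the squared differences for all monomials of positive degree.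

  The upper bound follows for every configuration (lemma \<open>discrete_energy_less\<close>): if the deficit
  were not positive, then \<open>\<nu>\<close> and \<open>\<sigma>\<close> would agree on all monomials, hence by Stone-Weierstrass on
  all continuous functions. This is absurd, because \<open>\<nu>\<close> lives on finitely many points of an infinite
  sphere and \<open>\<sigma>\<close> charges every nonempty open subset of the sphere.

  The lower bound is where greediness enters (lemma \<open>greedy_discrete_energy_greater\<close>). The value of
  the potential of the first \<open>n\<close> points at the next point is its maximum, which is at least its mean
  \<open>n * I\<close>; summing over \<open>n\<close> gives \<open>N * (N - 1) * I\<close>. Already the first of these inequalities is
  strict.

  The two bounds confine the deficit between \<open>0\<close> and \<open>I / N\<close>. It therefore tends to zero, which
  gives the limit of the energies. It also forces the differences for each fixed monomial to tend to
  zero, and a further use of Stone-Weierstrass (lemma \<open>discrepancy_continuous_tendsto_0\<close>) turns this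
  into weak-star convergence.
\<close>

section \<open>The binomial series of the kernel\<close>

lemma alternating_gbinomial_neg:
  fixes b :: real
  assumes "0 < b" "b < 1"
  shows "(-1) ^ Suc k * (b gchoose Suc k) < 0"
proof (induction k)
  case 0
  then show ?case using assms by simp
next
  case (Suc k)
  have "(b - real (Suc k)) * (b gchoose Suc k) = real (Suc (Suc k)) * (b gchoose Suc (Suc k))"
    using gbinomial_mult_1[of b "Suc k"] by (simp add: algebra_simps)
  then have "(b gchoose Suc (Suc k)) = (b - real (Suc k)) / real (Suc (Suc k)) * (b gchoose Suc k)"
    by (simp add: field_simps del: of_nat_Suc)
  then have "(-1) ^ Suc (Suc k) * (b gchoose Suc (Suc k)) =
      - ((b - real (Suc k)) / real (Suc (Suc k))) * ((-1) ^ Suc k * (b gchoose Suc k))"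
    by (simp only: power_Suc) simp
  also have "- ((b - real (Suc k)) / real (Suc (Suc k))) = (real (Suc k) - b) / real (Suc (Suc k))"
    by (simp only: minus_divide_left minus_diff_eq)
  finally have "(-1) ^ Suc (Suc k) * (b gchoose Suc (Suc k)) =
      (real (Suc k) - b) / real (Suc (Suc k)) * ((-1) ^ Suc k * (b gchoose Suc k))" .
  moreover have "(real (Suc k) - b) / real (Suc (Suc k)) > 0"
    using assms by simp
  ultimately show ?case
    using Suc.IH by (metis mult_pos_neg)
qed

text \<open>
  The terms of positive index of the series of \<open>1 - (1 - s) powr b\<close> are nonnegative for
  \<open>0 \<le> s < 1\<close>, so all its partial sums are at most \<open>1\<close>. The partial sums are polynomials in \<open>s\<close>,
  and letting \<open>s\<close> tend to \<open>1\<close> bounds the sums of the absolute values of the coefficients.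
\<close>

lemma summable_abs_gbinomial:
  fixes b :: real
  assumes "0 < b" "b < 1"
  shows "summable (\<lambda>k. \<bar>b gchoose k\<bar>)"
proof -
  let ?c = "\<lambda>k. (-1) ^ k * (b gchoose k)"
  have abs: "\<bar>b gchoose Suc k\<bar> = - ?c (Suc k)" for k
  proof -
    have "\<bar>b gchoose Suc k\<bar> = \<bar>?c (Suc k)\<bar>"
      by (simp add: abs_mult power_abs)
    then show ?thesis
      using alternating_gbinomial_neg[OF assms, of k] by (simp only: abs_of_neg)
  qed
  have partial: "(\<Sum>k<n. - ?c (Suc k) * s ^ Suc k) \<le> 1" if s: "0 \<le> s" "s < 1" for s n
  proof -
    have "(\<lambda>k. ?c k * s ^ k) sums (1 - s) powr b"
      using gen_binomial_real[of "-s" b] s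
      by (simp add: power_minus[of s] mult_ac)
    then have "(\<lambda>k. ?c (Suc k) * s ^ Suc k) sums ((1 - s) powr b - 1)"
      by (subst sums_Suc_iff) simp
    then have sm: "(\<lambda>k. - ?c (Suc k) * s ^ Suc k) sums (1 - (1 - s) powr b)"
      using sums_minus by fastforce
    have "(\<Sum>k<n. - ?c (Suc k) * s ^ Suc k) \<le> (\<Sum>k. - ?c (Suc k) * s ^ Suc k)"
      using sm s alternating_gbinomial_neg[OF assms]
      by (intro sum_le_suminf) (auto simp: sums_iff abs[symmetric] simp del: power_Suc intro!: mult_nonneg_nonneg)
    also have "\<dots> \<le> 1"
      using sm by (simp add: sums_iff)
    finally show ?thesis .
  qed
  have "(\<Sum>k<n. \<bar>b gchoose Suc k\<bar>) \<le> 1" for n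
  proof (rule tendsto_upperbound)
    show "((\<lambda>s. \<Sum>k<n. - ?c (Suc k) * s ^ Suc k) \<longlongrightarrow> (\<Sum>k<n. \<bar>b gchoose Suc k\<bar>)) (at_left 1)"
      unfolding abs by (auto intro!: tendsto_eq_intros)
    show "eventually (\<lambda>s. (\<Sum>k<n. - ?c (Suc k) * s ^ Suc k) \<le> 1) (at_left 1)"
      using partial eventually_at_left_real[of 0 1] by (auto elim: eventually_mono)
  qed auto
  then have "summable (\<lambda>k. \<bar>b gchoose Suc k\<bar>)"
    by (intro summableI_nonneg_bounded) auto
  then show ?thesis
    by (subst (asm) summable_Suc_iff)
qed

text \<open>
  Both sides are continuous on the closed interval and agree inside; the endpoints matter because
  the inner product of two unit vectors reaches \<open>1\<close> on the diagonal and \<open>-1\<close> at antipodes.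
\<close>

lemma one_minus_powr_sums:
  fixes b s :: real
  assumes b: "0 < b" "b < 1" and s: "\<bar>s\<bar> \<le> 1"
  shows "(\<lambda>k. (-1) ^ k * (b gchoose k) * s ^ k) sums ((1 - s) powr b)"
proof -
  let ?f = "\<lambda>k s. (-1) ^ k * (b gchoose k) * s ^ k"
  have bound: "norm (?f k t) \<le> \<bar>b gchoose k\<bar>" if "t \<in> {-1..1}" for k and t :: real
    using that by (auto simp: abs_mult power_abs intro!: mult_left_le power_le_one)
  have summ: "summable (\<lambda>k. ?f k t)" if "t \<in> {-1..1}" for t
    using summable_comparison_test'[OF summable_abs_gbinomial[OF b], of 0 "\<lambda>k. ?f k t"] bound[OF that]
    by simp
  have "uniform_limit {-1..1} (\<lambda>n t. \<Sum>k<n. ?f k t) (\<lambda>t. \<Sum>k. ?f k t) sequentially"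
    using bound summable_abs_gbinomial[OF b] by (intro Weierstrass_m_test) auto
  then have cont: "continuous_on {-1..1} (\<lambda>t. \<Sum>k. ?f k t)"
    by (rule uniform_limit_theorem[rotated]) (auto intro!: always_eventually continuous_intros)
  have "(\<Sum>k. ?f k s) - (1 - s) powr b = 0"
  proof (rule continuous_constant_on_closure[where S = "{-1<..<1}" and x = s
        and f = "\<lambda>t. (\<Sum>k. ?f k t) - (1 - t) powr b"])
    have "continuous_on {-1..1} (\<lambda>t. (1 - t) powr b)"
      using b by (intro continuous_on_powr' continuous_on_diff continuous_on_const continuous_on_id) auto
    with cont show "continuous_on (closure {-1<..<1}) (\<lambda>t. (\<Sum>k. ?f k t) - (1 - t) powr b)"
      by (simp add: continuous_on_diff)
    show "s \<in> closure {-1<..<1}"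
      using s by auto
    show "(\<Sum>k. ?f k t) - (1 - t) powr b = 0" if "t \<in> {-1<..<1}" for t
      using gen_binomial_real[of "-t" b] that
      by (simp add: power_minus[of t] mult_ac sums_iff abs_less_iff)
  qed
  then show ?thesis
    using summ[of s] s by (auto simp: sums_iff abs_le_iff)
qed

lemma norm_diff_powr_unit_vectors:
  fixes x y :: "'a::real_inner"
  assumes "norm x = 1" "norm y = 1"
  shows "norm (x - y) powr lam = 2 powr (lam / 2) * (1 - x \<bullet> y) powr (lam / 2)"
proof -
  have "(norm (x - y))\<^sup>2 = 2 * (1 - x \<bullet> y)"
    using assms by (simp add: power2_norm_eq_inner inner_diff inner_commute norm_eq_1)
  then have "norm (x - y) = sqrt (2 * (1 - x \<bullet> y))"
    by (metis norm_ge_zero real_sqrt_unique)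
  moreover have "x \<bullet> y \<le> 1"
    using Cauchy_Schwarz_ineq2[of x y] assms by simp
  ultimately have "norm (x - y) = (2 * (1 - x \<bullet> y)) powr (1 / 2)"
    by (simp add: powr_half_sqrt)
  then have "norm (x - y) powr lam = (2 * (1 - x \<bullet> y)) powr (lam / 2)"
    by (simp only: powr_powr times_divide_eq_left mult_1)
  also have "\<dots> = 2 powr (lam / 2) * (1 - x \<bullet> y) powr (lam / 2)"
    by (rule powr_mult)
  finally show ?thesis .
qed

section \<open>Word monomials\<close>

text \<open>
  Indexing by words, with every order of the factors listed separately, makes all coefficients in
  the expansion of the powers of the inner product equal to \<open>1\<close>, without multinomial
  coefficients.
\<close>

definition word_monomial :: "'a::euclidean_space list \<Rightarrow> 'a \<Rightarrow> real" where
  "word_monomial w x = (\<Prod>b\<leftarrow>w. x \<bullet> b)"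

definition basis_words :: "nat \<Rightarrow> 'a::euclidean_space list set" where
  "basis_words k = {w. set w \<subseteq> Basis \<and> length w = k}"

lemma word_monomial_Nil [simp]: "word_monomial [] = (\<lambda>x. 1)"
  and word_monomial_Cons [simp]: "word_monomial (b # w) x = (x \<bullet> b) * word_monomial w x"
  by (simp_all add: word_monomial_def fun_eq_iff)

lemma continuous_on_word_monomial [continuous_intros]: "continuous_on S (word_monomial w)"
proof (induction w)
  case Nil
  then show ?case by simp
next
  case (Cons b w)
  have "word_monomial (b # w) = (\<lambda>x. (x \<bullet> b) * word_monomial w x)" by auto
  then show ?case using Cons by (auto intro!: continuous_intros)
qed

lemma finite_basis_words [simp]: "finite (basis_words k)"
  unfolding basis_words_def by (rule finite_lists_length_eq) simp

lemma basis_words_0: "basis_words 0 = {[]}"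
  by (auto simp: basis_words_def)

lemma basis_words_Suc: "basis_words (Suc k) = (\<lambda>(b, w). b # w) ` (Basis \<times> basis_words k)"
  by (force simp: basis_words_def length_Suc_conv)

lemma inner_power_eq_sum_word_monomial:
  fixes x y :: "'a::euclidean_space"
  shows "(x \<bullet> y) ^ k = (\<Sum>w\<in>basis_words k. word_monomial w x * word_monomial w y)"
proof (induction k)
  case 0
  then show ?case by (simp add: basis_words_0)
next
  case (Suc k)
  have inj: "inj_on (\<lambda>(b, w). b # w) (Basis \<times> basis_words k :: ('a \<times> 'a list) set)"
    by (auto simp: inj_on_def)
  have "(x \<bullet> y) ^ Suc k = (\<Sum>b\<in>Basis. (x \<bullet> b) * (y \<bullet> b)) *
      (\<Sum>w\<in>basis_words k. word_monomial w x * word_monomial w y)"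
    using Suc by (simp add: euclidean_inner[of x y])
  also have "\<dots> = (\<Sum>(b, w)\<in>Basis \<times> basis_words k.
      word_monomial (b # w) x * word_monomial (b # w) y)"
    by (simp add: sum_product sum.cartesian_product mult_ac)
  also have "\<dots> = (\<Sum>w\<in>basis_words (Suc k). word_monomial w x * word_monomial w y)"
    unfolding basis_words_Suc by (subst sum.reindex[OF inj]) (simp add: case_prod_beta)
  finally show ?case .
qed

section \<open>Integration against the uniform measure\<close>

lemma measure_sphere_uniform_unit_sphere [simp]:
  "measure (sphere_uniform :: 'a::euclidean_space measure) unit_sphere = 1"
  using prob_space.prob_space[OF prob_space_sphere_uniform[where 'a = 'a]] by simp

lemma integrable_sphere_uniform:
  fixes f :: "'a::euclidean_space \<Rightarrow> real"
  assumes "continuous_on unit_sphere f"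
  shows "integrable sphere_uniform f"
proof -
  interpret prob_space "sphere_uniform :: 'a measure" by (rule prob_space_sphere_uniform)
  have "bounded (f ` unit_sphere)"
    using compact_continuous_image[OF assms] by (simp add: compact_imp_bounded)
  then obtain B where B: "\<And>x. x \<in> unit_sphere \<Longrightarrow> norm (f x) \<le> B"
    unfolding bounded_iff by (metis imageI)
  have "f \<in> borel_measurable sphere_borel"
    by (rule borel_measurable_continuous_on_restrict[OF assms])
  then have "f \<in> borel_measurable sphere_uniform"
    using measurable_cong_sets[OF sets_sphere_uniform refl] by blast
  then show ?thesis
    using B by (intro integrable_const_bound[of _ B] AE_I2) auto
qed

text \<open>
  An open set that meets the sphere in \<open>z\<close> contains the radial projections of a neighbourhood of
  \<open>z / 2\<close>, so it has positive cone measure; that is, the uniform measure has full support.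
\<close>

lemma integral_sphere_uniform_pos:
  fixes f :: "'a::euclidean_space \<Rightarrow> real"
  assumes f: "continuous_on unit_sphere f" and nonneg: "\<And>x. x \<in> unit_sphere \<Longrightarrow> 0 \<le> f x"
    and z: "z \<in> unit_sphere" "0 < f z"
  shows "0 < (\<integral>x. f x \<partial>sphere_uniform)"
proof -
  obtain U where U: "open U" "U \<inter> unit_sphere = f -` {0<..} \<inter> unit_sphere"
    using f open_greaterThan[of "0::real"] unfolding continuous_on_open_invariant by metis
  define A where "A = U \<inter> unit_sphere"
  have A: "A \<in> sets sphere_borel"
    using U(1) by (auto simp: A_def sets_restrict_space_iff intro!: sets.Int borel_open)
  define V where "V = (ball 0 1 - {0::'a}) \<inter> (\<lambda>x. x /\<^sub>R norm x) -` U"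
  have "open V"
    unfolding V_def using U(1)
    by (intro continuous_open_preimage) (auto intro!: continuous_intros open_Diff)
  moreover have "z /\<^sub>R 2 \<in> V"
    using z U by (auto simp: V_def)
  ultimately have "V \<notin> null_sets lborel"
    using open_not_negligible[of V] null_sets_completionI[of V lborel]
    by (auto simp: negligible_iff_null_sets)
  moreover have [measurable]: "V \<in> sets borel"
    using \<open>open V\<close> by simp
  ultimately have "emeasure lborel V \<noteq> 0"
    by (auto simp: null_sets_def)
  moreover have "{x \<in> ball 0 1. x /\<^sub>R norm x \<in> A} = V"
    by (auto simp: V_def A_def)
  ultimately have "emeasure sphere_uniform A \<noteq> 0"
    using emeasure_lborel_unit_ball(2)[where 'a = 'a]
    by (simp add: emeasure_sphere_uniform[OF A] ennreal_divide_eq_0_iff)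
  have "\<not> (AE x in sphere_uniform. f x = 0)"
  proof
    assume "AE x in sphere_uniform. f x = 0"
    then have "AE x in sphere_uniform. x \<notin> A"
      using U(2) by (auto elim: eventually_mono simp: A_def)
    then have "A \<in> null_sets sphere_uniform"
      using A sets.sets_into_space[OF A] by (subst (asm) AE_iff_null_sets[symmetric]) auto
    with \<open>emeasure sphere_uniform A \<noteq> 0\<close> show False by auto
  qed
  moreover have "AE x in sphere_uniform. 0 \<le> f x"
    by (rule AE_I2) (use nonneg in auto)
  ultimately show ?thesis
    using integral_nonneg_eq_0_iff_AE[OF integrable_sphere_uniform[OF f]]
      integral_nonneg_AE[of f sphere_uniform] by fastforce
qed

text \<open>
  Orthogonal transformations act transitively on the sphere, preserve the inner product and leave the
  uniform measure invariant.
\<close>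

lemma integral_zonal_const:
  fixes h :: "real \<Rightarrow> real" and y z :: "real ^ 'n"
  assumes h: "continuous_on {-1..1} h" and yz: "y \<in> unit_sphere" "z \<in> unit_sphere"
  shows "(\<integral>x. h (x \<bullet> y) \<partial>sphere_uniform) = (\<integral>x. h (x \<bullet> z) \<partial>sphere_uniform)"
proof -
  obtain T where T: "orthogonal_transformation T" "T z = y"
    using orthogonal_transformation_exists[of z y] yz by auto
  have nrm: "norm (T x) = norm x" for x
    using T by (simp add: orthogonal_transformation_norm)
  note [measurable] = borel_measurable_orthogonal_transformation[OF T(1)]
  have "T \<in> measurable sphere_borel sphere_borel"
    by (intro measurable_restrict_space2 measurable_restrict_space1)
       (auto simp: space_restrict_space nrm)
  then have Tm: "T \<in> measurable sphere_uniform sphere_borel"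
    using measurable_cong_sets[OF sets_sphere_uniform refl] by blast
  have "\<bar>x \<bullet> y\<bar> \<le> 1" if "norm x = 1" for x
    using Cauchy_Schwarz_ineq2[of x y] yz that by simp
  then have "continuous_on unit_sphere (\<lambda>x. h (x \<bullet> y))"
    by (intro continuous_on_compose2[OF h]) (auto intro!: continuous_intros simp: abs_le_iff)
  then have "(\<lambda>x. h (x \<bullet> y)) \<in> borel_measurable sphere_borel"
    by (rule borel_measurable_continuous_on_restrict)
  then have "(\<integral>x. h (x \<bullet> y) \<partial>distr sphere_uniform sphere_borel T) =
      (\<integral>x. h (T x \<bullet> y) \<partial>sphere_uniform)"
    by (rule integral_distr[OF Tm])
  moreover have "T x \<bullet> y = x \<bullet> z" for x
    using T by (auto simp: orthogonal_transformation_def)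
  ultimately show ?thesis
    by (simp add: sphere_uniform_rotation_invariant[OF T(1)])
qed

lemma integral_distance_powr_const:
  fixes y :: "real ^ 'n"
  assumes "0 < lam" "y \<in> unit_sphere"
  shows "(\<integral>x. norm (x - y) powr lam \<partial>sphere_uniform) = continuous_energy lam (sphere_uniform :: (real ^ 'n) measure)"
proof -
  interpret prob_space "sphere_uniform :: (real ^ 'n) measure" by (rule prob_space_sphere_uniform)
  let ?h = "\<lambda>t. 2 powr (lam / 2) * (1 - t) powr (lam / 2)"
  have h: "continuous_on {-1..1} ?h"
    using assms(1) by (intro continuous_on_mult continuous_on_powr' continuous_on_diff
        continuous_on_const continuous_on_id) auto
  have zonal: "(\<integral>x. norm (x - z) powr lam \<partial>sphere_uniform) = (\<integral>x. ?h (x \<bullet> z) \<partial>sphere_uniform)"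
    if "z \<in> unit_sphere" for z :: "real ^ 'n"
    using that by (intro Bochner_Integration.integral_cong) (auto simp: norm_diff_powr_unit_vectors)
  have "(\<integral>x. norm (z - x) powr lam \<partial>sphere_uniform) = (\<integral>x. norm (x - y) powr lam \<partial>sphere_uniform)"
    if "z \<in> unit_sphere" for z :: "real ^ 'n"
    unfolding norm_minus_commute[of z] zonal[OF that] zonal[OF assms(2)]
    by (rule integral_zonal_const[OF h that assms(2)])
  then have "continuous_energy lam (sphere_uniform :: (real ^ 'n) measure) =
      (\<integral>z. (\<integral>x. norm (x - y) powr lam \<partial>sphere_uniform) \<partial>(sphere_uniform :: (real ^ 'n) measure))"
    unfolding continuous_energy_def
    by (rule Bochner_Integration.integral_cong[OF refl]) simp
  then show ?thesis
    by simp
qed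

text \<open>
  The potential of the uniform measure at any point of the sphere is its energy, so integrating the
  binomial series of the kernel in one variable suffices. Summation and integration commute
  because the coefficients are absolutely summable.
\<close>

lemma integral_distance_powr_sums:
  fixes y :: "real ^ 'n"
  assumes lam: "0 < lam" "lam < 2" and y: "y \<in> unit_sphere"
  shows "(\<lambda>k. 2 powr (lam / 2) * ((-1) ^ k * (lam / 2 gchoose k)) * (\<integral>x. (x \<bullet> y) ^ k \<partial>sphere_uniform))
    sums continuous_energy lam (sphere_uniform :: (real ^ 'n) measure)"
proof -
  interpret prob_space "sphere_uniform :: (real ^ 'n) measure" by (rule prob_space_sphere_uniform)
  let ?f = "\<lambda>k x. (-1) ^ k * (lam / 2 gchoose k) * (x \<bullet> y) ^ k"
  have b: "0 < lam / 2" "lam / 2 < 1" using lam by auto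
  note summ = summable_abs_gbinomial[OF b]
  have inner: "\<bar>x \<bullet> y\<bar> \<le> 1" if "x \<in> unit_sphere" for x
    using Cauchy_Schwarz_ineq2[of x y] y that by simp
  have bound: "norm (?f k x) \<le> \<bar>lam / 2 gchoose k\<bar>" if "x \<in> unit_sphere" for x k
    using inner[OF that] by (auto simp: abs_mult power_abs intro!: mult_left_le power_le_one)
  have int: "integrable sphere_uniform (?f k)" for k
    by (intro integrable_sphere_uniform continuous_intros)
  have series: "(\<lambda>k. \<integral>x. ?f k x \<partial>sphere_uniform) sums (\<integral>x. (\<Sum>k. ?f k x) \<partial>sphere_uniform)"
  proof (rule sums_integral[OF int])
    show "AE x in sphere_uniform. summable (\<lambda>k. norm (?f k x))"
      using bound by (intro AE_I2 summable_comparison_test'[OF summ, of 0]) auto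
    have "(\<integral>x. norm (?f k x) \<partial>sphere_uniform) \<le> \<bar>lam / 2 gchoose k\<bar>" for k
      using bound int by (intro integral_le_const AE_I2) auto
    then show "summable (\<lambda>k. \<integral>x. norm (?f k x) \<partial>sphere_uniform)"
      by (intro summable_comparison_test'[OF summ, of 0]) (auto simp: integral_nonneg_AE)
  qed
  have "(\<integral>x. (\<Sum>k. ?f k x) \<partial>sphere_uniform) = (\<integral>x. (1 - x \<bullet> y) powr (lam / 2) \<partial>sphere_uniform)"
    using one_minus_powr_sums[OF b inner]
    by (intro Bochner_Integration.integral_cong) (auto simp: sums_iff)
  moreover have "2 powr (lam / 2) * (\<integral>x. (1 - x \<bullet> y) powr (lam / 2) \<partial>sphere_uniform) =
      continuous_energy lam (sphere_uniform :: (real ^ 'n) measure)"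
    unfolding integral_distance_powr_const[OF lam(1) y, symmetric] integral_mult_right_zero[symmetric]
    using y by (intro Bochner_Integration.integral_cong) (auto simp: norm_diff_powr_unit_vectors)
  ultimately have total: "2 powr (lam / 2) * (\<integral>x. (\<Sum>k. ?f k x) \<partial>sphere_uniform) =
      continuous_energy lam (sphere_uniform :: (real ^ 'n) measure)"
    by (simp only:)
  show ?thesis
    using sums_mult[OF series, of "2 powr (lam / 2)"] unfolding total by (simp add: mult.assoc)
qed

section \<open>Discrepancies and the energy deficit\<close>

definition discrepancy :: "nat \<Rightarrow> (nat \<Rightarrow> 'a::euclidean_space) \<Rightarrow> ('a \<Rightarrow> real) \<Rightarrow> real" where
  "discrepancy N a f = (\<Sum>k<N. f (a k)) / real N - (\<integral>x. f x \<partial>sphere_uniform)"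

lemma discrepancy_add:
  assumes "continuous_on unit_sphere f" "continuous_on unit_sphere g"
  shows "discrepancy N a (\<lambda>x. f x + g x) = discrepancy N a f + discrepancy N a g"
  using assms by (simp add: discrepancy_def integrable_sphere_uniform sum.distrib add_divide_distrib)

lemma discrepancy_cmult: "discrepancy N a (\<lambda>x. c * f x) = c * discrepancy N a f"
  by (simp add: discrepancy_def right_diff_distrib flip: sum_distrib_left)

lemma discrepancy_sum:
  assumes "\<And>i. i \<in> I \<Longrightarrow> continuous_on unit_sphere (f i)"
  shows "discrepancy N a (\<lambda>x. \<Sum>i\<in>I. f i x) = (\<Sum>i\<in>I. discrepancy N a (f i))"
  using assms
proof (induction I rule: infinite_finite_induct)
  case (insert i I)
  then show ?case
    by (simp add: discrepancy_add continuous_on_sum)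
qed (simp_all add: discrepancy_def)

lemma abs_discrepancy_le:
  fixes a :: "nat \<Rightarrow> 'a::euclidean_space"
  assumes f: "continuous_on unit_sphere f" and bound: "\<And>x. x \<in> unit_sphere \<Longrightarrow> \<bar>f x\<bar> \<le> e"
    and a: "\<And>n. a n \<in> unit_sphere"
  shows "\<bar>discrepancy N a f\<bar> \<le> 2 * e"
proof -
  interpret prob_space "sphere_uniform :: 'a measure" by (rule prob_space_sphere_uniform)
  have "0 \<le> e"
    using bound[OF a[of 0]] by linarith
  have "\<bar>\<Sum>k<N. f (a k)\<bar> \<le> (\<Sum>k<N. e)"
    using bound a by (intro order.trans[OF sum_abs] sum_mono) auto
  then have "\<bar>(\<Sum>k<N. f (a k)) / real N\<bar> \<le> e"
    using \<open>0 \<le> e\<close> by (cases "N = 0") (simp_all add: divide_le_eq mult.commute)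
  moreover have "\<bar>\<integral>x. f x \<partial>sphere_uniform\<bar> \<le> (\<integral>x. \<bar>f x\<bar> \<partial>sphere_uniform)"
    by (rule integral_abs_bound)
  moreover have "(\<integral>x. \<bar>f x\<bar> \<partial>sphere_uniform) \<le> e"
    using f bound by (intro integral_le_const integrable_sphere_uniform AE_I2 continuous_intros) auto
  ultimately show ?thesis
    unfolding discrepancy_def by linarith
qed

lemma discrepancy_word_monomial_Nil [simp]:
  "N > 0 \<Longrightarrow> discrepancy N a (word_monomial []) = 0"
  by (simp add: discrepancy_def)

text \<open>
  The double integral of \<open>(x \<bullet> y) ^ k\<close> against the signed measure \<open>\<mu>\<close> whose integrals are the
  discrepancies, computed in two ways. Rotation invariance makes the two mixed terms and the term
  of the uniform measure with itself all equal up to sign, so that only one of them survives.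
\<close>

lemma sum_discrepancy_squared:
  fixes a :: "nat \<Rightarrow> real ^ 'n" and y :: "real ^ 'n"
  assumes N: "N > 0" and a: "\<And>n. a n \<in> unit_sphere" and y: "y \<in> unit_sphere"
  shows "(\<Sum>w\<in>basis_words k. (discrepancy N a (word_monomial w))\<^sup>2) =
    (\<Sum>i<N. \<Sum>j<N. (a i \<bullet> a j) ^ k) / (real N)\<^sup>2 - (\<integral>x. (x \<bullet> y) ^ k \<partial>sphere_uniform)"
proof -
  interpret prob_space "sphere_uniform :: (real ^ 'n) measure" by (rule prob_space_sphere_uniform)
  define W where "W = (basis_words k :: (real ^ 'n) list set)"
  define m where "m = (\<integral>x. (x \<bullet> y) ^ k \<partial>sphere_uniform)"
  define J where "J = (\<lambda>w. \<integral>x. word_monomial w (x :: real ^ 'n) \<partial>sphere_uniform)"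
  define A where "A = (\<lambda>w. (\<Sum>i<N. word_monomial w (a i)) / real N)"
  note int = integrable_sphere_uniform[OF continuous_on_word_monomial]
  have J_m: "(\<Sum>w\<in>W. J w * word_monomial w z) = m" if z: "z \<in> unit_sphere" for z
  proof -
    have "(\<Sum>w\<in>W. J w * word_monomial w z) =
        (\<integral>x. (\<Sum>w\<in>W. word_monomial w x * word_monomial w z) \<partial>sphere_uniform)"
      unfolding J_def using int by (subst Bochner_Integration.integral_sum) auto
    also have "\<dots> = (\<integral>x. (x \<bullet> z) ^ k \<partial>sphere_uniform)"
      by (simp add: inner_power_eq_sum_word_monomial W_def)
    also have "\<dots> = m"
      unfolding m_def using z y
      by (intro integral_zonal_const[of "\<lambda>t. t ^ k"]) (auto intro!: continuous_intros)
    finally show ?thesis .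
  qed
  have "(\<Sum>w\<in>W. (A w)\<^sup>2) = (\<Sum>w\<in>W. \<Sum>i<N. \<Sum>j<N. word_monomial w (a i) * word_monomial w (a j)) / (real N)\<^sup>2"
    by (simp add: A_def power_divide power2_eq_square sum_product sum_divide_distrib)
  also have "(\<Sum>w\<in>W. \<Sum>i<N. \<Sum>j<N. word_monomial w (a i) * word_monomial w (a j)) =
      (\<Sum>i<N. \<Sum>j<N. (a i \<bullet> a j) ^ k)"
    unfolding inner_power_eq_sum_word_monomial W_def[symmetric]
    by (subst sum.swap) (intro sum.cong refl sum.swap)
  finally have AA: "(\<Sum>w\<in>W. (A w)\<^sup>2) = (\<Sum>i<N. \<Sum>j<N. (a i \<bullet> a j) ^ k) / (real N)\<^sup>2" .
  have "(\<Sum>w\<in>W. A w * J w) = (\<Sum>w\<in>W. \<Sum>i<N. J w * word_monomial w (a i)) / real N"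
    by (simp add: A_def sum_divide_distrib sum_distrib_left mult.commute)
  also have "(\<Sum>w\<in>W. \<Sum>i<N. J w * word_monomial w (a i)) = (\<Sum>i<N. m)"
    by (subst sum.swap) (simp add: J_m[OF a])
  finally have AJ: "(\<Sum>w\<in>W. A w * J w) = m"
    using N by simp
  have "(\<Sum>w\<in>W. (J w)\<^sup>2) = (\<integral>z. (\<Sum>w\<in>W. J w * word_monomial w z) \<partial>sphere_uniform)"
    using int by (subst Bochner_Integration.integral_sum) (auto simp: power2_eq_square J_def)
  also have "\<dots> = (\<integral>z. m \<partial>(sphere_uniform :: (real ^ 'n) measure))"
    by (intro Bochner_Integration.integral_cong) (auto simp: J_m)
  finally have JJ: "(\<Sum>w\<in>W. (J w)\<^sup>2) = m"
    by simp
  have "discrepancy N a (word_monomial w) = A w - J w" for w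
    by (simp add: discrepancy_def A_def J_def)
  then have "(\<Sum>w\<in>W. (discrepancy N a (word_monomial w))\<^sup>2) =
      (\<Sum>w\<in>W. (A w)\<^sup>2) - 2 * (\<Sum>w\<in>W. A w * J w) + (\<Sum>w\<in>W. (J w)\<^sup>2)"
    by (simp add: power2_diff sum.distrib sum_subtractf sum_distrib_left mult.assoc)
  then show ?thesis
    unfolding AA AJ JJ unfolding W_def m_def by simp
qed

lemma discrete_energy_eq_double_sum:
  "discrete_energy lam N a = (\<Sum>i<N. \<Sum>j<N. norm (a i - a j) powr lam)"
proof -
  have "(\<Sum>i<N. \<Sum>j<N. norm (a i - a j) powr lam) =
      (\<Sum>(i, j)\<in>{..<N} \<times> {..<N}. norm (a i - a j) powr lam)"
    by (rule sum.cartesian_product)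
  also have "\<dots> = discrete_energy lam N a"
    unfolding discrete_energy_def by (rule sum.mono_neutral_right) auto
  finally show ?thesis ..
qed

text \<open>
  The coefficients \<open>(-1) ^ k * (lam / 2 gchoose k)\<close> are negative for \<open>k > 0\<close>, and the discrepancy
  of the constant monomial vanishes, so this writes the deficit as a series of nonnegative terms
  that controls the discrepancy of every monomial.
\<close>

lemma energy_deficit_sums:
  fixes a :: "nat \<Rightarrow> real ^ 'n"
  assumes lam: "0 < lam" "lam < 2" and N: "N > 0" and a: "\<And>n. a n \<in> unit_sphere"
  shows "(\<lambda>k. 2 powr (lam / 2) * (- ((-1) ^ k * (lam / 2 gchoose k))) *
      (\<Sum>w\<in>basis_words k. (discrepancy N a (word_monomial w))\<^sup>2))
    sums (continuous_energy lam (sphere_uniform :: (real ^ 'n) measure) - discrete_energy lam N a / (real N)\<^sup>2)"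
proof -
  let ?c = "\<lambda>k. 2 powr (lam / 2) * ((-1) ^ k * (lam / 2 gchoose k))"
  have pair: "(\<lambda>k. ?c k * (a i \<bullet> a j) ^ k) sums (norm (a i - a j) powr lam)" for i j
  proof -
    have "\<bar>a i \<bullet> a j\<bar> \<le> 1"
      using Cauchy_Schwarz_ineq2[of "a i" "a j"] a by simp
    then have "(\<lambda>k. (-1) ^ k * (lam / 2 gchoose k) * (a i \<bullet> a j) ^ k) sums ((1 - a i \<bullet> a j) powr (lam / 2))"
      using lam by (intro one_minus_powr_sums) auto
    from sums_mult[OF this, of "2 powr (lam / 2)"] show ?thesis
      using a by (simp add: norm_diff_powr_unit_vectors mult.assoc)
  qed
  have "(\<lambda>k. \<Sum>i<N. \<Sum>j<N. ?c k * (a i \<bullet> a j) ^ k) sums discrete_energy lam N a"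
    unfolding discrete_energy_eq_double_sum by (intro sums_sum pair)
  then have "(\<lambda>k. ?c k * ((\<Sum>i<N. \<Sum>j<N. (a i \<bullet> a j) ^ k) / (real N)\<^sup>2))
      sums (discrete_energy lam N a / (real N)\<^sup>2)"
    using sums_divide[of _ _ "(real N)\<^sup>2"] by (simp add: sum_distrib_left[symmetric])
  from sums_diff[OF integral_distance_powr_sums[OF lam a[of 0]] this] show ?thesis
    by (rule sums_cong[THEN iffD1, rotated])
       (simp add: sum_discrepancy_squared[OF N a a[of 0]] algebra_simps)
qed

lemma energy_deficit_term_nonneg:
  fixes a :: "nat \<Rightarrow> 'a::euclidean_space"
  assumes "0 < lam" "lam < 2" "N > 0"
  shows "0 \<le> 2 powr (lam / 2) * (- ((-1) ^ k * (lam / 2 gchoose k))) *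
      (\<Sum>w\<in>basis_words k. (discrepancy N a (word_monomial w))\<^sup>2)"
proof (cases k)
  case 0
  then show ?thesis
    using assms(3) discrepancy_word_monomial_Nil[of N a] by (simp add: basis_words_0 del: word_monomial_Nil)
next
  case (Suc l)
  then show ?thesis
    using alternating_gbinomial_neg[of "lam / 2" l] assms
    by (intro mult_nonneg_nonneg sum_nonneg) auto
qed

text \<open>The constant comes from the binomial coefficient of index \<open>length w\<close>, so it serves all
  configurations of all sizes.\<close>

lemma discrepancy_word_monomial_le_energy_deficit:
  fixes w :: "(real ^ 'n) list"
  assumes lam: "0 < lam" "lam < 2" and w: "set w \<subseteq> Basis" "w \<noteq> []"
  obtains C where "C > 0"
    "\<And>N a. N > 0 \<Longrightarrow> (\<And>n. a n \<in> unit_sphere) \<Longrightarrow>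
      C * (discrepancy N a (word_monomial w))\<^sup>2 \<le>
      continuous_energy lam (sphere_uniform :: (real ^ 'n) measure) - discrete_energy lam N a / (real N)\<^sup>2"
proof
  define C where "C = 2 powr (lam / 2) * (- ((-1) ^ length w * (lam / 2 gchoose length w)))"
  show "C > 0"
    using alternating_gbinomial_neg[of "lam / 2" "length w - 1"] lam w by (simp add: C_def mult_less_0_iff)
  fix N :: nat and a :: "nat \<Rightarrow> real ^ 'n"
  assume N: "N > 0" and a: "\<And>n. a n \<in> unit_sphere"
  let ?D = "\<lambda>k. \<Sum>w\<in>basis_words k. (discrepancy N a (word_monomial w))\<^sup>2"
  let ?t = "\<lambda>k. 2 powr (lam / 2) * (- ((-1) ^ k * (lam / 2 gchoose k))) * ?D k"
  note sums = energy_deficit_sums[OF lam N a]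
  have "(discrepancy N a (word_monomial w))\<^sup>2 \<le> ?D (length w)"
    using w by (intro member_le_sum) (auto simp: basis_words_def intro: finite_lists_length_eq)
  then have "C * (discrepancy N a (word_monomial w))\<^sup>2 \<le> ?t (length w)"
    using \<open>C > 0\<close> by (simp only: C_def[symmetric]) (rule mult_left_mono, auto)
  also have "\<dots> \<le> suminf ?t"
    using sum_le_suminf[OF sums_summable[OF sums] _ energy_deficit_term_nonneg[OF lam N],
        of "{length w}"] by simp
  also have "\<dots> = continuous_energy lam (sphere_uniform :: (real ^ 'n) measure) - discrete_energy lam N a / (real N)\<^sup>2"
    using sums_unique[OF sums] by simp
  finally show "C * (discrepancy N a (word_monomial w))\<^sup>2 \<le>
      continuous_energy lam (sphere_uniform :: (real ^ 'n) measure) - discrete_energy lam N a / (real N)\<^sup>2" .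
qed

section \<open>From monomials to continuous functions\<close>

text \<open>
  The extra factor \<open>g\<close> turns the induction over products into two applications of the induction
  hypothesis, the first of which replaces \<open>g\<close> by its product with a factor. Sequences of
  functionals are allowed so that one proof serves both for vanishing and for convergence to zero.
\<close>

lemma discrepancy_polynomial_tendsto_0:
  fixes p g :: "'a::euclidean_space \<Rightarrow> real"
  assumes "real_polynomial_function p" and "continuous_on unit_sphere g"
    and "\<And>w. set w \<subseteq> Basis \<Longrightarrow>
      (\<lambda>n. discrepancy (\<kappa> n) a (\<lambda>x. word_monomial w x * g x)) \<longlonglongrightarrow> 0"
    and "set w \<subseteq> Basis"
  shows "(\<lambda>n. discrepancy (\<kappa> n) a (\<lambda>x. word_monomial w x * (g x * p x))) \<longlonglongrightarrow> 0"
  using assms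
proof (induction p arbitrary: g w rule: real_polynomial_function.induct)
  case (linear h)
  have eq: "word_monomial w x * (g x * h x) = (\<Sum>b\<in>Basis. h b * (word_monomial (b # w) x * g x))" for x
  proof -
    have "h x = h (\<Sum>b\<in>Basis. (x \<bullet> b) *\<^sub>R b)"
      by (simp add: euclidean_representation)
    also have "\<dots> = (\<Sum>b\<in>Basis. (x \<bullet> b) * h b)"
      using linear.hyps by (simp add: bounded_linear.linear linear_sum linear_scale)
    finally show ?thesis
      by (simp add: sum_distrib_left mult_ac)
  qed
  have "discrepancy (\<kappa> n) a (\<lambda>x. word_monomial w x * (g x * h x)) =
      (\<Sum>b\<in>Basis. h b * discrepancy (\<kappa> n) a (\<lambda>x. word_monomial (b # w) x * g x))" for n
    unfolding eq using linear.prems(1)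
    by (subst discrepancy_sum) (auto intro!: continuous_intros simp: discrepancy_cmult simp del: word_monomial_Cons)
  moreover have "(\<lambda>n. \<Sum>b\<in>Basis. h b * discrepancy (\<kappa> n) a (\<lambda>x. word_monomial (b # w) x * g x)) \<longlonglongrightarrow> 0"
    using linear.prems(3)
    by (intro tendsto_null_sum tendsto_mult_right_zero linear.prems(2)) auto
  ultimately show ?case by simp
next
  case (const c)
  then show ?case
    using discrepancy_cmult[of _ a c "\<lambda>x. word_monomial w x * g x"]
    by (simp add: mult_ac tendsto_mult_right_zero)
next
  case (add p q)
  have cont: "continuous_on unit_sphere p" "continuous_on unit_sphere q"
    using add.hyps by (simp_all add: continuous_on_polymonial_function real_polynomial_function_eq)
  have "discrepancy (\<kappa> n) a (\<lambda>x. word_monomial w x * (g x * (p x + q x))) =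
      discrepancy (\<kappa> n) a (\<lambda>x. word_monomial w x * (g x * p x)) +
      discrepancy (\<kappa> n) a (\<lambda>x. word_monomial w x * (g x * q x))" for n
    using cont add.prems(1) by (subst discrepancy_add[symmetric])
      (auto intro!: continuous_intros simp: algebra_simps)
  then show ?case
    using tendsto_add_zero[OF add.IH(1)[OF add.prems] add.IH(2)[OF add.prems]] by simp
next
  case (mult p q)
  have "continuous_on unit_sphere p"
    using mult.hyps by (intro continuous_on_polymonial_function) (simp add: real_polynomial_function_eq)
  then have "continuous_on unit_sphere (\<lambda>x. g x * p x)"
    using mult.prems(1) by (auto intro!: continuous_intros)
  from mult.IH(2)[OF this mult.IH(1)[OF mult.prems(1,2)] mult.prems(3)] show ?case
    by (simp add: mult.assoc)
qed

text \<open>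
  Discrepancies are bounded by twice the supremum norm whatever the number of points, so a uniform
  approximation by one polynomial serves all \<open>n\<close> at once.
\<close>

lemma discrepancy_continuous_tendsto_0:
  fixes f :: "'a::euclidean_space \<Rightarrow> real"
  assumes f: "continuous_on unit_sphere f" and a: "\<And>n. a n \<in> unit_sphere"
    and monomials: "\<And>w. set w \<subseteq> Basis \<Longrightarrow> (\<lambda>n. discrepancy (\<kappa> n) a (word_monomial w)) \<longlonglongrightarrow> 0"
  shows "(\<lambda>n. discrepancy (\<kappa> n) a f) \<longlonglongrightarrow> 0"
proof (rule tendstoI)
  fix e :: real
  assume "e > 0"
  then obtain p where p: "real_polynomial_function p" "\<And>x. x \<in> unit_sphere \<Longrightarrow> \<bar>f x - p x\<bar> < e / 3"
    using Stone_Weierstrass_real_polynomial_function[of unit_sphere f "e / 3"] f by auto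
  have contp: "continuous_on unit_sphere p"
    using p by (intro continuous_on_polymonial_function) (simp add: real_polynomial_function_eq)
  have "(\<lambda>n. discrepancy (\<kappa> n) a p) \<longlonglongrightarrow> 0"
    using discrepancy_polynomial_tendsto_0[OF p(1), of "\<lambda>_. 1" \<kappa> a "[]"] monomials by simp
  then have "eventually (\<lambda>n. dist (discrepancy (\<kappa> n) a p) 0 < e / 3) sequentially"
    using \<open>e > 0\<close> by (intro tendstoD) auto
  then show "eventually (\<lambda>n. dist (discrepancy (\<kappa> n) a f) 0 < e) sequentially"
  proof eventually_elim
    case (elim n)
    have "discrepancy (\<kappa> n) a f = discrepancy (\<kappa> n) a p + discrepancy (\<kappa> n) a (\<lambda>x. f x - p x)"
      using f contp by (subst discrepancy_add[symmetric]) (auto intro!: continuous_intros)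
    moreover have "\<bar>discrepancy (\<kappa> n) a (\<lambda>x. f x - p x)\<bar> \<le> 2 * (e / 3)"
      using f contp p(2) a by (intro abs_discrepancy_le) (auto intro!: continuous_intros less_imp_le)
    ultimately show ?case
      using elim by (simp add: dist_real_def)
  qed
qed

section \<open>Upper bound for arbitrary configurations\<close>

lemma infinite_unit_sphere:
  assumes "2 \<le> DIM('a::euclidean_space)"
  shows "infinite (unit_sphere :: 'a set)"
proof
  assume fin: "finite (unit_sphere :: 'a set)"
  obtain u :: 'a where u: "norm u = 1"
    using vector_choose_size[of 1] by auto
  obtain v where "(unit_sphere :: 'a set) = {v}"
    using fin connected_finite_iff_sing[OF connected_sphere[OF assms, of 0 1]] u by auto
  moreover have "u \<in> unit_sphere" "- u \<in> unit_sphere"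
    using u by auto
  ultimately have "u = - u" by (metis singletonD)
  then have "2 *\<^sub>R u = 0" by (metis scaleR_2 add.right_inverse)
  then have "u = 0" by simp
  with u show False by simp
qed

text \<open>
  A vanishing deficit would make every discrepancy vanish. The distances to the points multiply to
  a nonnegative function whose sum over the points is zero and whose integral is not.
\<close>

lemma discrete_energy_less:
  fixes a :: "nat \<Rightarrow> real ^ 'n"
  assumes lam: "0 < lam" "lam < 2" and N: "N > 0" and a: "\<And>n. a n \<in> unit_sphere"
    and dim: "2 \<le> CARD('n)"
  shows "discrete_energy lam N a < (real N)\<^sup>2 * continuous_energy lam (sphere_uniform :: (real ^ 'n) measure)"
proof -
  let ?E = "continuous_energy lam (sphere_uniform :: (real ^ 'n) measure) - discrete_energy lam N a / (real N)\<^sup>2"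
  have "?E > 0"
  proof (rule ccontr)
    assume "\<not> ?E > 0"
    have "discrepancy N a (word_monomial w) = 0" if w: "set w \<subseteq> Basis" for w
    proof (cases "w = []")
      case True
      then show ?thesis
        using N by (simp del: word_monomial_Nil)
    next
      case False
      obtain C where C: "C > 0" "C * (discrepancy N a (word_monomial w))\<^sup>2 \<le> ?E"
        using discrepancy_word_monomial_le_energy_deficit[OF lam w False] N a by metis
      then show ?thesis
        using \<open>\<not> ?E > 0\<close> by (smt (verit) mult_pos_pos zero_less_power2)
    qed
    then have zero: "discrepancy N a f = 0" if "continuous_on unit_sphere f" for f
      using discrepancy_continuous_tendsto_0[OF that a, of "\<lambda>_. N"] by (simp add: LIMSEQ_const_iff)
    define f where "f = (\<lambda>x. \<Prod>i<N. norm (x - a i))"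
    have f: "continuous_on unit_sphere f"
      unfolding f_def by (intro continuous_intros)
    have "infinite (unit_sphere :: (real ^ 'n) set)"
      using dim by (intro infinite_unit_sphere) simp
    then obtain z where z: "z \<in> unit_sphere" "z \<notin> a ` {..<N}"
      by (meson finite_imageI finite_lessThan finite_subset subsetI)
    have "0 < (\<integral>x. f x \<partial>sphere_uniform)"
      using z by (intro integral_sphere_uniform_pos[OF f _ z(1)]) (auto simp: f_def intro!: prod_nonneg prod_pos)
    moreover have "f (a k) = 0" if "k < N" for k
      using that by (auto simp: f_def)
    ultimately show False
      using zero[OF f] by (simp add: discrepancy_def)
  qed
  then show ?thesis
    using N by (simp add: field_simps)
qed

section \<open>Greedy sequences\<close>

text \<open>
  The maximum of the potential of the first \<open>n\<close> points is at least its mean over the sphere. For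
  \<open>n = 1\<close> the inequality is strict because the potential vanishes at \<open>a 0\<close> and is positive at the
  antipode; this alone makes the final lower bound strict.
\<close>

lemma greedy_potential_ge:
  fixes a :: "nat \<Rightarrow> real ^ 'n"
  assumes lam: "0 < lam" and greedy: "greedy_energy_sequence lam a" and n: "n \<ge> 1"
  shows "real n * continuous_energy lam (sphere_uniform :: (real ^ 'n) measure) \<le>
      (\<Sum>k<n. norm (a n - a k) powr lam)"
    and "n = 1 \<Longrightarrow> real n * continuous_energy lam (sphere_uniform :: (real ^ 'n) measure) <
      (\<Sum>k<n. norm (a n - a k) powr lam)"
proof -
  interpret prob_space "sphere_uniform :: (real ^ 'n) measure" by (rule prob_space_sphere_uniform)
  have a: "\<And>k. a k \<in> unit_sphere"
    and max: "\<And>x. x \<in> unit_sphere \<Longrightarrow>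
        (\<Sum>k<n. norm (x - a k) powr lam) \<le> (\<Sum>k<n. norm (a n - a k) powr lam)"
    using greedy n by (auto simp: greedy_energy_sequence_def)
  let ?u = "\<lambda>x. \<Sum>k<n. norm (x - a k) powr lam"
  have cont_pow: "continuous_on unit_sphere (\<lambda>x. norm (x - z) powr lam)" for z :: "real ^ 'n"
    using lam by (intro continuous_on_powr' continuous_intros) auto
  then have cont: "continuous_on unit_sphere ?u"
    by (intro continuous_on_sum)
  have "(\<integral>x. ?u x \<partial>sphere_uniform) = (\<Sum>k<n. \<integral>x. norm (x - a k) powr lam \<partial>sphere_uniform)"
    using cont_pow by (intro Bochner_Integration.integral_sum integrable_sphere_uniform)
  then have mean: "(\<integral>x. ?u x \<partial>sphere_uniform) =
      real n * continuous_energy lam (sphere_uniform :: (real ^ 'n) measure)"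
    by (simp add: integral_distance_powr_const[OF lam a])
  show "real n * continuous_energy lam (sphere_uniform :: (real ^ 'n) measure) \<le> ?u (a n)"
    unfolding mean[symmetric] using max
    by (intro integral_le_const integrable_sphere_uniform cont AE_I2) auto
  show "real n * continuous_energy lam (sphere_uniform :: (real ^ 'n) measure) < ?u (a n)" if "n = 1"
  proof -
    have "- a 0 - a 0 = - (2 *\<^sub>R a 0)"
      by (simp add: scaleR_2)
    then have "norm (- a 0 - a 0) = 2"
      using a[of 0] by (simp only: norm_minus_cancel norm_scaleR) simp
    then have "?u (a 0) < ?u (- a 0)"
      using that by simp
    also have "\<dots> \<le> ?u (a n)"
      using max[of "- a 0"] a[of 0] by simp
    finally have "0 < (\<integral>x. ?u (a n) - ?u x \<partial>sphere_uniform)"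
      using max a cont
      by (intro integral_sphere_uniform_pos[of _ "a 0"]) (auto intro!: continuous_intros)
    then show ?thesis
      using cont mean by (simp add: integrable_sphere_uniform)
  qed
qed

lemma discrete_energy_Suc:
  "discrete_energy lam (Suc N) a = discrete_energy lam N a + 2 * (\<Sum>k<N. norm (a N - a k) powr lam)"
  by (simp add: discrete_energy_eq_double_sum sum.distrib norm_minus_commute[of "a N"])

lemma greedy_discrete_energy_greater:
  fixes a :: "nat \<Rightarrow> real ^ 'n"
  assumes lam: "0 < lam" and greedy: "greedy_energy_sequence lam a" and N: "N \<ge> 2"
  shows "real N * (real N - 1) * continuous_energy lam (sphere_uniform :: (real ^ 'n) measure) <
      discrete_energy lam N a"
  using N
proof (induction N rule: dec_induct)
  case base
  have "discrete_energy lam 2 a = 2 * (\<Sum>k<1. norm (a 1 - a k) powr lam)"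
    using discrete_energy_Suc[of lam 1 a] by (simp add: numeral_2_eq_2 discrete_energy_eq_double_sum)
  then show ?case
    using greedy_potential_ge(2)[OF lam greedy, of 1] by simp
next
  case (step N)
  then show ?case
    using greedy_potential_ge(1)[OF lam greedy, of N]
    by (simp add: discrete_energy_Suc algebra_simps)
qed

section \<open>Limits of energies and empirical measures\<close>

text \<open>
  As an image of the uniform counting measure on the indices, the empirical measure counts repeated
  points with their multiplicity.
\<close>

lemma integral_empirical_measure:
  fixes f :: "'a::euclidean_space \<Rightarrow> real"
  assumes N: "N > 0" and a: "\<And>n. a n \<in> unit_sphere" and f: "continuous_on unit_sphere f"
  shows "(\<integral>x. f x \<partial>empirical_measure N a) = (\<Sum>k<N. f (a k)) / real N"
proof -
  let ?U = "uniform_count_measure {..<N}"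
  have am: "a \<in> measurable ?U sphere_borel"
    using a by (auto simp: measurable_cong_sets[OF sets_uniform_count_measure_count_space refl]
        space_restrict_space)
  have "empirical_measure N a = distr ?U sphere_borel a"
  proof (rule measure_eqI)
    fix A assume "A \<in> sets (empirical_measure N a)"
    then have A: "A \<in> sets sphere_borel" by simp
    let ?K = "a -` A \<inter> {..<N}"
    have "(\<Sum>k<N. emeasure (return sphere_borel (a k)) A) = (\<Sum>k<N. indicator ?K k)"
      using A a by (intro sum.cong) (auto simp: indicator_def space_restrict_space)
    also have "\<dots> = of_nat (card ?K)"
      by (auto simp: indicator_def sum.If_cases intro!: arg_cong[where f = card])
    finally show "emeasure (empirical_measure N a) A = emeasure (distr ?U sphere_borel a) A"
      using emeasure_distr[OF am A] N
      by (simp add: emeasure_empirical_measure[OF A] space_uniform_count_measure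
          emeasure_uniform_count_measure ennreal_of_nat_eq_real_of_nat flip: ennreal_mult)
  qed simp
  then have "(\<integral>x. f x \<partial>empirical_measure N a) = (\<integral>k. f (a k) \<partial>?U)"
    using integral_distr[OF am borel_measurable_continuous_on_restrict[OF f]] by simp
  then show ?thesis
    by (simp add: integral_uniform_count_measure)
qed

theorem theorem3p1:
  fixes a :: "nat \<Rightarrow> real ^ 'n" and lam :: real and d :: nat
  assumes "0 < lam" and "lam < 2"
    and "d \<ge> 1" and "CARD('n) = d + 1"
    and "greedy_energy_sequence lam a"
  shows "(\<forall>N\<ge>2.
            real N * (real N - 1) * continuous_energy lam (sphere_uniform :: (real ^ 'n) measure)
              < discrete_energy lam N a \<and>
            discrete_energy lam N a
              < (real N)\<^sup>2 * continuous_energy lam (sphere_uniform :: (real ^ 'n) measure))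
       \<and> (\<lambda>N. discrete_energy lam N a / (real N)\<^sup>2)
            \<longlonglongrightarrow> continuous_energy lam (sphere_uniform :: (real ^ 'n) measure)
       \<and> weak_star_converges (\<lambda>N. empirical_measure N a) sphere_uniform"
proof -
  define I where "I = continuous_energy lam (sphere_uniform :: (real ^ 'n) measure)"
  have a: "a n \<in> unit_sphere" for n
    using assms(5) by (simp add: greedy_energy_sequence_def)
  have lower: "real N * (real N - 1) * I < discrete_energy lam N a" if "N \<ge> 2" for N
    unfolding I_def by (rule greedy_discrete_energy_greater[OF assms(1,5) that])
  have upper: "discrete_energy lam N a < (real N)\<^sup>2 * I" if "N > 0" for N
    unfolding I_def using assms(3,4) by (intro discrete_energy_less[OF assms(1,2) that a]) simp
  have limit: "(\<lambda>N. discrete_energy lam N a / (real N)\<^sup>2) \<longlonglongrightarrow> I"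
  proof (rule tendsto_sandwich)
    have "(\<lambda>N. I - I * (1 / real N)) \<longlonglongrightarrow> I - I * 0"
      by (intro tendsto_intros lim_1_over_n)
    then show "(\<lambda>N. I - I * (1 / real N)) \<longlonglongrightarrow> I" by simp
    show "eventually (\<lambda>N. I - I * (1 / real N) \<le> discrete_energy lam N a / (real N)\<^sup>2) sequentially"
      using eventually_ge_at_top[of 2]
    proof eventually_elim
      case (elim N)
      have "I - I * (1 / real N) = real N * (real N - 1) * I / (real N)\<^sup>2"
        using elim by (simp add: field_simps power2_eq_square)
      then show ?case
        using divide_right_mono[OF less_imp_le[OF lower[OF elim]], of "(real N)\<^sup>2"] by simp
    qed
    show "eventually (\<lambda>N. discrete_energy lam N a / (real N)\<^sup>2 \<le> I) sequentially"
      using eventually_gt_at_top[of 0]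
    proof eventually_elim
      case (elim N)
      then show ?case
        using upper[OF elim] by (simp add: field_simps)
    qed
  qed simp
  have monomials: "(\<lambda>N. discrepancy N a (word_monomial w)) \<longlonglongrightarrow> 0" if w: "set w \<subseteq> Basis" for w
  proof (cases "w = []")
    case True
    have "eventually (\<lambda>N. discrepancy N a (word_monomial w) = 0) sequentially"
      using eventually_gt_at_top[of 0]
      by eventually_elim (use True in \<open>simp del: word_monomial_Nil\<close>)
    then show ?thesis
      by (rule tendsto_eventually)
  next
    case False
    obtain C where C: "C > 0" "\<And>N. N > 0 \<Longrightarrow>
        C * (discrepancy N a (word_monomial w))\<^sup>2 \<le> I - discrete_energy lam N a / (real N)\<^sup>2"
      using discrepancy_word_monomial_le_energy_deficit[OF assms(1,2) w False] a unfolding I_def by metis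
    have "(\<lambda>N. (discrepancy N a (word_monomial w))\<^sup>2) \<longlonglongrightarrow> 0"
    proof (rule tendsto_sandwich[of "\<lambda>_. 0"])
      have "(\<lambda>N. (I - discrete_energy lam N a / (real N)\<^sup>2) / C) \<longlonglongrightarrow> (I - I) / C"
        by (intro tendsto_intros limit) (use C in auto)
      then show "(\<lambda>N. (I - discrete_energy lam N a / (real N)\<^sup>2) / C) \<longlonglongrightarrow> 0" by simp
      show "eventually (\<lambda>N. (discrepancy N a (word_monomial w))\<^sup>2 \<le>
          (I - discrete_energy lam N a / (real N)\<^sup>2) / C) sequentially"
        using eventually_gt_at_top[of 0]
        by eventually_elim (use C in \<open>simp add: pos_le_divide_eq mult.commute\<close>)
    qed auto
    from tendsto_real_sqrt[OF this] show ?thesis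
      by (simp add: tendsto_rabs_zero_iff)
  qed
  have "weak_star_converges (\<lambda>N. empirical_measure N a) sphere_uniform"
    unfolding weak_star_converges_def
  proof (intro allI impI)
    fix f :: "real ^ 'n \<Rightarrow> real"
    assume f: "continuous_on unit_sphere f"
    have "(\<lambda>N. discrepancy N a f) \<longlonglongrightarrow> 0"
      by (rule discrepancy_continuous_tendsto_0[OF f a monomials])
    then have "(\<lambda>N. (\<Sum>k<N. f (a k)) / real N) \<longlonglongrightarrow> (\<integral>x. f x \<partial>sphere_uniform)"
      unfolding discrepancy_def by (simp add: LIM_zero_iff)
    moreover have "eventually (\<lambda>N. (\<integral>x. f x \<partial>empirical_measure N a) = (\<Sum>k<N. f (a k)) / real N) sequentially"
      using eventually_gt_at_top[of 0]
      by eventually_elim (rule integral_empirical_measure[OF _ a f])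
    ultimately show "(\<lambda>N. \<integral>x. f x \<partial>empirical_measure N a) \<longlonglongrightarrow> (\<integral>x. f x \<partial>sphere_uniform)"
      using tendsto_cong by fastforce
  qed
  then show ?thesis
    using lower upper limit unfolding I_def by auto
qed

end
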